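(* Let $0<\lambda\leq1$. For every $f\in\mathcal{U}(\lambda)$ one has $$|S'_f(0)|\leq 12\lambda.$$ This bound is sharp, i.e., for each such $\lambda$ there is a function $f\in\mathcal{U}(\lambda)$ for which equality holds.
   Context: Let $\mathbb{D}=\{z\in\mathbb{C}:|z|<1\}$, and let $\mathcal{A}$ be the family of functions $f$ analytic in $\mathbb{D}$ with $f(0)=0$ and $f'(0)=1$. For $0<\lambda\leq1$, $\mathcal{U}(\lambda)$ is the class of $f\in\mathcal{A}$ with $f(z)\neq0$ for $0<|z|<1$ (so that the following expression is defined, with $z/f(z)$ taken to be $1$ at $z=0$) and $$\left|\left(\frac{z}{f(z)}\right)^2f'(z)-1\right|<\lambda\quad\text{for all } z\in\mathbb{D}.$$ Functions in $\mathcal{U}(\lambda)$ are univalent in $\mathbb{D}$. For a locally univalent function $f$ in $\mathbb{D}$, the Schwarzian derivative is $$S_f(z)=\left(\frac{f''(z)}{f'(z)}\right)'-\frac12\left(\frac{f''(z)}{f'(z)}\right)^2,$$ and $S'_f(0)$ denotes the value at $0$ of the derivative of the function $S_f$. *)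

theory Defs
  imports "HOL-Complex_Analysis.Complex_Analysis"
begin

(* Values of f outside the unit disc are unconstrained. They are also irrelevant: the disc is open,
   so every derivative taken at a point of it depends only on f inside the disc. *)
definition class_A :: "(complex \<Rightarrow> complex) set" where
  "class_A = {f. f holomorphic_on ball 0 1 \<and> f 0 = 0 \<and> deriv f 0 = 1}"

(* The function z / f z with the removable singularity at 0 filled in; this is the correct value
   for f in class_A, whereas the total division would give 0 / 0 = 0. *)
definition id_over :: "(complex \<Rightarrow> complex) \<Rightarrow> complex \<Rightarrow> complex" where
  "id_over f z = (if z = 0 then 1 else z / f z)"

definition class_U :: "real \<Rightarrow> (complex \<Rightarrow> complex) set" where
  "class_U lam = {f \<in> class_A.
     (\<forall>z. 0 < norm z \<and> norm z < 1 \<longrightarrow> f z \<noteq> 0) \<and>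
     (\<forall>z\<in>ball 0 1. norm ((id_over f z)\<^sup>2 * deriv f z - 1) < lam)}"

definition pre_schwarzian :: "(complex \<Rightarrow> complex) \<Rightarrow> complex \<Rightarrow> complex" where
  "pre_schwarzian f z = deriv (deriv f) z / deriv f z"

(* Meaningful where deriv f does not vanish. On the unit disc this holds for every f in class_U lam
   with lam <= 1, since deriv f z = 0 would give norm (0 - 1) < lam. *)
definition schwarzian :: "(complex \<Rightarrow> complex) \<Rightarrow> complex \<Rightarrow> complex" where
  "schwarzian f z = deriv (pre_schwarzian f) z - 1 / 2 * (pre_schwarzian f z)\<^sup>2"

end

theory Submission
  imports Defs
begin

text \<open>
  Put \<open>g z = z / f z\<close> and \<open>w z = (z / f z)\<^sup>2 f' z - 1\<close>. Then \<open>w z = g z - z g' z - 1\<close>, and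
  expanding the Schwarzian of \<open>z / g z\<close> at the origin gives \<open>S\<^sub>f' 0 = -4 g''' 0 = 2 w''' 0\<close>.
  Cauchy's inequality for \<open>w\<close>, which is bounded by \<open>\<lambda>\<close> on the disc, yields the bound; equality
  holds when \<open>w z = \<lambda> z\<^sup>3\<close>, that is, for \<open>f z = z / (1 - \<lambda> z\<^sup>3 / 2)\<close>.
\<close>

text \<open>Differentiation is local, so formulas for \<open>deriv f\<close> that hold only on an
  open set can be differentiated again. This drives the chains of higher derivatives below.\<close>

lemma deriv_transform_open:
  assumes "(h has_field_derivative D) (at z)" "open S" "z \<in> S" "\<And>x. x \<in> S \<Longrightarrow> f x = h x"
  shows "deriv f z = D"
  using has_field_derivative_transform_within_open[OF assms(1-3)] assms(4)
  by (metis DERIV_imp_deriv)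

text \<open>With \<open>N = g - z g'\<close> the quotient rule gives \<open>f' = N / g^2\<close>,
  and \<open>N' = - z g''\<close> has no first-order term in \<open>g\<close>. Hence
  \<open>f'' / f' = N' / N - 2 g' / g\<close> stays simple enough to differentiate twice more by
  hand.\<close>

lemma deriv_schwarzian_id_div:
  assumes S: "open S" "0 \<in> S" and g: "g holomorphic_on S"
    and f: "\<And>z. z \<in> S \<Longrightarrow> f z = z / g z"
    and nz: "\<And>z. z \<in> S \<Longrightarrow> g z \<noteq> 0" "\<And>z. z \<in> S \<Longrightarrow> g z - z * deriv g z \<noteq> 0"
    and "g 0 = 1"
  shows "deriv (schwarzian f) 0 = - 4 * (deriv ^^ 3) g 0"
proof -
  define g1 g2 g3 where "g1 = deriv g" and "g2 = deriv g1" and "g3 = deriv g2"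
  have "g1 holomorphic_on S" "g2 holomorphic_on S" "g3 holomorphic_on S"
    unfolding g1_def g2_def g3_def by (intro holomorphic_deriv g S)+
  then have d: "(g has_field_derivative g1 z) (at z)" "(g1 has_field_derivative g2 z) (at z)"
    "(g2 has_field_derivative g3 z) (at z)" "(g3 has_field_derivative deriv g3 z) (at z)"
    if "z \<in> S" for z
    using that S g by (auto simp: g1_def g2_def g3_def intro: holomorphic_derivI)
  define N where "N z = g z - z * g1 z" for z
  have N: "N z \<noteq> 0" if "z \<in> S" for z
    using nz that by (simp add: N_def g1_def)
  have dN: "(N has_field_derivative - z * g2 z) (at z)" if "z \<in> S" for z
    unfolding N_def using that by (auto intro!: derivative_eq_intros d)
  note nz = nz(1) N
  have f1: "deriv f z = N z / (g z)\<^sup>2" if z: "z \<in> S" for z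
  proof (rule deriv_transform_open[OF _ S(1) z f])
    show "((\<lambda>z. z / g z) has_field_derivative N z / (g z)\<^sup>2) (at z)"
      using nz[OF z] by (auto intro!: derivative_eq_intros d z simp: N_def power2_eq_square)
  qed
  have f2: "deriv (deriv f) z = - z * g2 z / (g z)\<^sup>2 - 2 * N z * g1 z / (g z)^3" if z: "z \<in> S" for z
  proof (rule deriv_transform_open[OF _ S(1) z f1])
    show "((\<lambda>z. N z / (g z)\<^sup>2) has_field_derivative
        - z * g2 z / (g z)\<^sup>2 - 2 * N z * g1 z / (g z)^3) (at z)"
      using nz[OF z] by (auto intro!: derivative_eq_intros d dN z
          simp: field_simps power2_eq_square power3_eq_cube)
  qed
  have pre: "pre_schwarzian f z = - z * g2 z / N z - 2 * g1 z / g z" if z: "z \<in> S" for z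
    using nz[OF z] by (simp add: pre_schwarzian_def f1 f2 z field_simps power2_eq_square power3_eq_cube)
  have dpre: "deriv (pre_schwarzian f) z =
      - (g2 z + z * g3 z) / N z - (z * g2 z / N z)\<^sup>2 - 2 * g2 z / g z + 2 * (g1 z / g z)\<^sup>2"
    if z: "z \<in> S" for z
  proof (rule deriv_transform_open[OF _ S(1) z pre])
    show "((\<lambda>z. - z * g2 z / N z - 2 * g1 z / g z) has_field_derivative
        - (g2 z + z * g3 z) / N z - (z * g2 z / N z)\<^sup>2 - 2 * g2 z / g z + 2 * (g1 z / g z)\<^sup>2) (at z)"
      using nz[OF z] by (auto intro!: derivative_eq_intros d dN z
          simp: field_simps power2_eq_square)
  qed
  \<comment> \<open>The term \<open>2 * (g1 z / g z)\<^sup>2\<close> of the derivative cancels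
    against half the square of the pre-Schwarzian.\<close>
  have schw: "schwarzian f z = - (g2 z + z * g3 z) / N z - 3 / 2 * (z * g2 z / N z)\<^sup>2
      - 2 * g2 z / g z - 2 * z * g2 z * g1 z / (N z * g z)" if z: "z \<in> S" for z
    using nz[OF z] by (simp add: schwarzian_def pre dpre z field_simps power2_eq_square)
  \<comment> \<open>At 0, \<open>N\<close> and \<open>g\<close> equal 1 and \<open>N' = 0\<close>.
    The first and third terms contribute \<open>- 2 * g3 0\<close> each; the products
    \<open>g1 0 * g2 0\<close> from the last two terms cancel.\<close>
  have "deriv (schwarzian f) 0 = - 4 * g3 0"
  proof (rule deriv_transform_open[OF _ S schw])
    have "N 0 = 1"
      using \<open>g 0 = 1\<close> by (simp add: N_def)
    then show "((\<lambda>z. - (g2 z + z * g3 z) / N z - 3 / 2 * (z * g2 z / N z)\<^sup>2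
      - 2 * g2 z / g z - 2 * z * g2 z * g1 z / (N z * g z)) has_field_derivative - 4 * g3 0) (at 0)"
      using \<open>g 0 = 1\<close>
      by (auto intro!: derivative_eq_intros d dN S simp: field_simps)
  qed
  then show ?thesis
    by (simp add: g1_def g2_def g3_def numeral_3_eq_3)
qed

text \<open>Nothing is assumed on the bounding circle, so Cauchy's inequality is applied on radii
  \<open>s < r\<close>, and then \<open>s\<close> tends to \<open>r\<close> from the left.\<close>

lemma Cauchy_inequality_open_ball:
  assumes h: "h holomorphic_on ball a r" and "0 < r"
    and B: "\<And>z. z \<in> ball a r \<Longrightarrow> norm (h z) \<le> B"
  shows "norm ((deriv ^^ n) h a) \<le> fact n * B / r ^ n"
proof -
  have "norm ((deriv ^^ n) h a) \<le> fact n * B / s ^ n" if s: "0 < s" "s < r" for s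
  proof (rule Cauchy_inequality)
    have sub: "cball a s \<subseteq> ball a r"
      using s by (simp add: subset_iff)
    then show "continuous_on (cball a s) h"
      by (meson h holomorphic_on_imp_continuous_on holomorphic_on_subset)
    show "h holomorphic_on ball a s"
      using h s by (meson holomorphic_on_subset subset_ball less_imp_le)
    show "norm (h x) \<le> B" if "norm (a - x) = s" for x
      using B sub that by (auto simp: dist_norm subset_iff)
  qed (use s in auto)
  then have "eventually (\<lambda>s. norm ((deriv ^^ n) h a) \<le> fact n * B / s ^ n) (at_left r)"
    using eventually_at_left_real[OF \<open>0 < r\<close>] by (auto elim!: eventually_mono)
  moreover have "((\<lambda>s. fact n * B / s ^ n) \<longlongrightarrow> fact n * B / r ^ n) (at_left r)"
    using \<open>0 < r\<close> by (auto intro!: tendsto_eq_intros)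
  ultimately show ?thesis
    by (intro tendsto_lowerbound) auto
qed

text \<open>The quotient \<open>f z / z\<close> extends holomorphically over 0 with value
  \<open>deriv f 0 = 1\<close>. The extension \<open>k\<close> has no zeros, and
  \<open>id_over f\<close> is its reciprocal.\<close>

lemma holomorphic_id_over:
  assumes "f \<in> class_A" "\<And>z. 0 < norm z \<Longrightarrow> norm z < 1 \<Longrightarrow> f z \<noteq> 0"
  shows "id_over f holomorphic_on ball 0 1"
proof -
  define k where "k z = (if z = 0 then deriv f 0 else (f z - f 0) / (z - 0))" for z
  have "k holomorphic_on ball 0 1"
    unfolding k_def using assms(1) by (intro pole_lemma) (auto simp: class_A_def)
  moreover have "k z \<noteq> 0" if "z \<in> ball 0 1" for z
    using assms that by (simp add: k_def class_A_def)
  ultimately have "(\<lambda>z. 1 / k z) holomorphic_on ball 0 1"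
    by (intro holomorphic_intros)
  moreover have "1 / k z = id_over f z" for z
    using assms(1) by (simp add: k_def id_over_def class_A_def)
  ultimately show ?thesis by simp
qed

text \<open>Passing from \<open>g\<close> to \<open>g - z g'\<close> multiplies the Taylor
  coefficient of \<open>z ^ n\<close> by \<open>1 - n\<close>, which is -2 for
  \<open>n = 3\<close>.\<close>

lemma higher_deriv_3_sub_mult_deriv_at_0:
  assumes S: "open S" "0 \<in> S" and g: "g holomorphic_on S"
  shows "(deriv ^^ 3) (\<lambda>z. g z - z * deriv g z - c) 0 = - 2 * (deriv ^^ 3) g 0"
proof -
  define h where "h z = g z - z * deriv g z - c" for z
  have d: "(deriv g has_field_derivative deriv (deriv g) z) (at z)"
    "(deriv (deriv g) has_field_derivative deriv (deriv (deriv g)) z) (at z)"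
    "(deriv (deriv (deriv g)) has_field_derivative deriv (deriv (deriv (deriv g))) z) (at z)"
    "(g has_field_derivative deriv g z) (at z)"
    if "z \<in> S" for z
    using that S g by (auto intro!: holomorphic_derivI[of _ S] holomorphic_deriv)
  have h1: "deriv h z = - z * deriv (deriv g) z" if z: "z \<in> S" for z
    unfolding h_def
    by (rule DERIV_imp_deriv) (auto intro!: derivative_eq_intros d z)
  have h2: "deriv (deriv h) z = - deriv (deriv g) z - z * deriv (deriv (deriv g)) z" if z: "z \<in> S" for z
    by (rule deriv_transform_open[OF _ S(1) z h1]) (auto intro!: derivative_eq_intros d z)
  have "deriv (deriv (deriv h)) 0 = - 2 * deriv (deriv (deriv g)) 0"
    by (rule deriv_transform_open[OF _ S h2]) (auto intro!: derivative_eq_intros d S)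
  then show ?thesis
    by (simp add: h_def[abs_def] numeral_3_eq_3)
qed

text \<open>The factor \<open>(g z)\<^sup>2\<close> cancels the denominator from the quotient rule.
  This turns the condition defining \<open>class_U\<close> into one that is affine in
  \<open>g\<close>.\<close>

lemma id_over_sq_mult_deriv:
  assumes g: "g holomorphic_on ball 0 1" "\<And>z. z \<in> ball 0 1 \<Longrightarrow> g z \<noteq> 0"
    and f: "\<And>z. z \<in> ball 0 1 \<Longrightarrow> f z = z / g z"
    and id: "\<And>z. z \<in> ball 0 1 \<Longrightarrow> id_over f z = g z" and z: "z \<in> ball 0 1"
  shows "(id_over f z)\<^sup>2 * deriv f z = g z - z * deriv g z"
proof -
  have "deriv f z = (g z - z * deriv g z) / (g z)\<^sup>2"
    using g(2)[OF z]
    by (intro deriv_transform_open[OF _ open_ball z f])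
       (auto intro!: derivative_eq_intros holomorphic_derivI[OF g(1) open_ball z] 
             simp: power2_eq_square)
  then show ?thesis
    using g(2)[OF z] by (simp add: id[OF z])
qed

lemma norm_deriv_schwarzian_le:
  assumes "lam \<le> 1" and f: "f \<in> class_U lam"
  shows "norm (deriv (schwarzian f) 0) \<le> 12 * lam"
proof -
  define g where "g = id_over f"
  define w where "w z = g z - z * deriv g z - 1" for z
  have f_nz: "f z \<noteq> 0" if "0 < norm z" "norm z < 1" for z
    using f that by (auto simp: class_U_def)
  have A: "f \<in> class_A" and f0: "f 0 = 0"
    using f by (auto simp: class_U_def class_A_def)
  have g: "g holomorphic_on ball 0 1"
    using holomorphic_id_over[OF A f_nz] by (simp add: g_def)
  have g_nz: "g z \<noteq> 0" if "z \<in> ball 0 1" for z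
    using f_nz[of z] that by (auto simp: g_def id_over_def)
  \<comment> \<open>This holds even at zeros of \<open>f\<close> outside the disc: there
    \<open>g z = z / 0 = 0\<close>, and both sides are 0.\<close>
  have fg: "f z = z / g z" for z
    using f0 by (auto simp: g_def id_over_def)
  have w_less: "norm (w z) < lam" if z: "z \<in> ball 0 1" for z
  proof -
    have "norm ((id_over f z)\<^sup>2 * deriv f z - 1) < lam"
      using f z unfolding class_U_def by blast
    also have "(id_over f z)\<^sup>2 * deriv f z = g z - z * deriv g z"
      by (rule id_over_sq_mult_deriv[OF g g_nz fg _ z]) (auto simp: g_def)
    finally show ?thesis by (simp add: w_def)
  qed
  \<comment> \<open>A zero would give \<open>w z = -1\<close>, contradicting
    \<open>norm (w z) < lam \<le> 1\<close>.\<close>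
  have "g z - z * deriv g z \<noteq> 0" if "z \<in> ball 0 1" for z
    using w_less[OF that] \<open>lam \<le> 1\<close> by (auto simp: w_def)
  moreover have "g 0 = 1"
    by (simp add: g_def id_over_def)
  ultimately have "deriv (schwarzian f) 0 = - 4 * (deriv ^^ 3) g 0"
    using deriv_schwarzian_id_div[OF _ _ g fg g_nz] by simp
  also have "\<dots> = 2 * (deriv ^^ 3) w 0"
    using higher_deriv_3_sub_mult_deriv_at_0[OF _ _ g, of 1] by (simp add: w_def[abs_def])
  also have "norm \<dots> \<le> 2 * (fact 3 * lam / 1 ^ 3)"
  proof -
    have "w holomorphic_on ball 0 1"
      unfolding w_def[abs_def] by (intro holomorphic_intros g) auto
    then have "norm ((deriv ^^ 3) w 0) \<le> fact 3 * lam / 1 ^ 3"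
      using w_less by (intro Cauchy_inequality_open_ball) (auto intro: less_imp_le)
    then show ?thesis by (simp add: norm_mult)
  qed
  finally show ?thesis
    by (simp add: fact_numeral)
qed

text \<open>A multiple of \<open>z ^ 3\<close> attains Cauchy's bound for the third derivative at 0.
  Solving \<open>g - z g' - 1 = lam z^3\<close> divides the cubic coefficient by
  \<open>1 - 3\<close>, whence the \<open>- lam / 2\<close> in the denominator of
  \<open>f\<close>.\<close>

lemma schwarzian_extremal:
  fixes lam :: real
  assumes lam: "0 < lam" "lam \<le> 1"
  defines "f \<equiv> \<lambda>z. z / (1 - of_real lam / 2 * z ^ 3)"
  shows "f \<in> class_U lam" "deriv (schwarzian f) 0 = 12 * of_real lam"
proof -
  define g :: "complex \<Rightarrow> complex" where "g z = 1 - of_real lam / 2 * z ^ 3" for z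
  have g: "g holomorphic_on ball 0 1"
    unfolding g_def by (intro holomorphic_intros) auto
  have cube: "norm z ^ 3 < 1" if "z \<in> ball 0 1" for z :: complex
    using that by (simp add: power_less_one_iff)
  have g_nz: "g z \<noteq> 0" if z: "z \<in> ball 0 1" for z
  proof
    assume "g z = 0"
    then have "norm (of_real lam / 2 * z ^ 3) = norm (1 :: complex)"
      by (simp add: g_def)
    \<comment> \<open>A zero of \<open>g\<close> forces \<open>lam * norm z ^ 3 = 2\<close>.\<close>
    moreover have "lam * norm z ^ 3 \<le> 1 * 1"
      using lam cube[OF z] by (intro mult_mono) auto
    ultimately show False
      using lam by (simp add: norm_mult norm_power norm_divide)
  qed
  have fg: "f z = z / g z" for z
    by (simp add: f_def g_def)
  have id: "id_over f z = g z" if "z \<in> ball 0 1" for z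
    using g_nz[OF that] by (auto simp: id_over_def fg) (simp add: g_def)
  have g': "deriv g = (\<lambda>z. - 3 / 2 * of_real lam * z ^ 2)"
    by (rule ext, rule DERIV_imp_deriv, unfold g_def) (auto intro!: derivative_eq_intros)
  have g'': "deriv (deriv g) = (\<lambda>z. - 3 * of_real lam * z)"
    unfolding g' by (rule ext, rule DERIV_imp_deriv) (auto intro!: derivative_eq_intros)
  have g''': "deriv (deriv (deriv g)) = (\<lambda>z. - 3 * of_real lam)"
    unfolding g'' by (rule ext, rule DERIV_imp_deriv) (auto intro!: derivative_eq_intros)
  have w: "g z - z * deriv g z - 1 = of_real lam * z ^ 3" for z
    unfolding g' g_def by (simp add: power2_eq_square power3_eq_cube)
  \<comment> \<open>The value \<open>lam\<close> would be reached only on the unit circle, so the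
    inequality is strict in the open disc.\<close>
  have less: "norm (g z - z * deriv g z - 1) < lam" if "z \<in> ball 0 1" for z
    unfolding w using cube[OF that] lam by (simp add: norm_mult norm_power)
  have "deriv f 0 = 1"
    using id_over_sq_mult_deriv[OF g g_nz fg id, of 0] by (simp add: id_over_def g_def)
  then have "f \<in> class_A"
    unfolding class_A_def fg[abs_def] using g g_nz by (auto intro!: holomorphic_intros)
  then show "f \<in> class_U lam"
    using less g_nz id_over_sq_mult_deriv[OF g g_nz fg id] by (auto simp: class_U_def fg)
  have nz: "g z - z * deriv g z \<noteq> 0" if "z \<in> ball 0 1" for z
    using less[OF that] lam by auto
  have "deriv (schwarzian f) 0 = - 4 * (deriv ^^ 3) g 0"
    by (rule deriv_schwarzian_id_div[OF _ _ g fg g_nz nz]) (auto simp: g_def)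
  then show "deriv (schwarzian f) 0 = 12 * of_real lam"
    by (simp add: numeral_3_eq_3 g''')
qed

theorem theorem4:
  fixes lam :: real
  assumes "0 < lam" and "lam \<le> 1"
  shows "(\<forall>f\<in>class_U lam. norm (deriv (schwarzian f) 0) \<le> 12 * lam) \<and>
         (\<exists>f\<in>class_U lam. norm (deriv (schwarzian f) 0) = 12 * lam)"
proof (intro conjI ballI)
  show "\<exists>f\<in>class_U lam. norm (deriv (schwarzian f) 0) = 12 * lam"
    using schwarzian_extremal[OF assms] assms by (intro bexI) (auto simp: norm_mult)
qed (rule norm_deriv_schwarzian_le[OF assms(2)])

end
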